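(* Let $\varphi\colon S\to S'$ be a semiring homomorphism and let $\varphi_!\colon \mathrm{Spec}_k(S')\to\mathrm{Spec}_k(S)$ be the map $\varphi_!(Q):=Q^c$. Then: (1) A $k$-prime ideal $P$ of $S$ is the $k$-contraction of a $k$-prime ideal of $S'$ if and only if $P^{ec}=P$. (2) Every $k$-prime ideal of $S$ is a $k$-contracted ideal if and only if $\varphi_!$ is surjective. (3) If every $k$-prime ideal of $S'$ is a $k$-extended ideal, then $\varphi_!$ is injective.
   Context: A semiring is a commutative semiring $(S,+,0,\cdot,1)$ with multiplicative identity $1$ and additive identity $0$ that is absorbing. Semiring homomorphisms preserve $+,\cdot,0,1$. An ideal is a nonempty subset closed under addition and under multiplication by elements of $S$. A $k$-ideal is an ideal $I$ such that $x+y\in I$ and $y\in I$ imply $x\in I$. The $k$-closure of an ideal $I$ is $\mathcal{C}_k(I)=\{s\in S: s+x\in I \text{ for some } x\in I\}$, the least $k$-ideal containing $I$. A $k$-ideal $I$ is $k$-prime if for all $k$-ideals $A,B$, $AB\subseteq I$ implies $A\subseteq I$ or $B\subseteq I$, where $AB$ is the ideal of finite sums of products $ab$ with $a\in A$, $b\in B$. $\mathrm{Spec}_k(S)$ is the set of $k$-prime ideals of $S$. For a $k$-ideal $J$ of $S'$, its $k$-contraction is $J^c=\varphi^{-1}(J)$ (a $k$-ideal of $S$, $k$-prime if $J$ is); for a $k$-ideal $I$ of $S$, its $k$-extension is $I^e=\mathcal{C}_k(\langle\varphi(I)\rangle)$, where $\langle X\rangle$ is the ideal generated by $X$; $P^{ec}=(P^e)^c$.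 A $k$-contracted ideal of $S$ is one of the form $J^c$ for some $k$-ideal $J$ of $S'$; a $k$-extended ideal of $S'$ is one of the form $I^e$ for some $k$-ideal $I$ of $S$. *)

theory Defs
  imports "HOL-Algebra.Ideal_Product"
begin

(* The trivial semiring (zero = one) is not excluded. *)
definition comm_semiring_struct :: "('a, 'm) ring_scheme \<Rightarrow> bool" where
  "comm_semiring_struct S \<longleftrightarrow> semiring S \<and> comm_monoid S"

(* ring_hom does not ask for preservation of zero, which is not automatic without negatives. *)
definition semiring_hom ::
    "('a, 'm) ring_scheme \<Rightarrow> ('b, 'n) ring_scheme \<Rightarrow> ('a \<Rightarrow> 'b) set" where
  "semiring_hom S S' = {\<phi> \<in> ring_hom S S'. \<phi> \<zero>\<^bsub>S\<^esub> = \<zero>\<^bsub>S'\<^esub>}"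

definition semiring_ideal :: "('a, 'm) ring_scheme \<Rightarrow> 'a set \<Rightarrow> bool" where
  "semiring_ideal S I \<longleftrightarrow> I \<subseteq> carrier S \<and> I \<noteq> {} \<and>
     (\<forall>x\<in>I. \<forall>y\<in>I. x \<oplus>\<^bsub>S\<^esub> y \<in> I) \<and>
     (\<forall>s\<in>carrier S. \<forall>x\<in>I. s \<otimes>\<^bsub>S\<^esub> x \<in> I)"

definition k_ideal :: "('a, 'm) ring_scheme \<Rightarrow> 'a set \<Rightarrow> bool" where
  "k_ideal S I \<longleftrightarrow> semiring_ideal S I \<and>
     (\<forall>x\<in>carrier S. \<forall>y\<in>carrier S. x \<oplus>\<^bsub>S\<^esub> y \<in> I \<and> y \<in> I \<longrightarrow> x \<in> I)"

definition k_closure :: "('a, 'm) ring_scheme \<Rightarrow> 'a set \<Rightarrow> 'a set" where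
  "k_closure S I = {s \<in> carrier S. \<exists>x\<in>I. s \<oplus>\<^bsub>S\<^esub> x \<in> I}"

(* Analogue of genideal, which ranges over ideals of rings only. *)
definition gen_semiring_ideal :: "('a, 'm) ring_scheme \<Rightarrow> 'a set \<Rightarrow> 'a set" where
  "gen_semiring_ideal S X = Inter {I. semiring_ideal S I \<and> X \<subseteq> I}"

(* ideal_prod S A B consists of the nonempty finite sums of products a \<otimes> b; the empty sum is
   among them, as \<zero> = \<zero> \<otimes> \<zero>. Primes are not required to be proper: the carrier itself is k-prime. *)
definition k_prime :: "('a, 'm) ring_scheme \<Rightarrow> 'a set \<Rightarrow> bool" where
  "k_prime S I \<longleftrightarrow> k_ideal S I \<and>
     (\<forall>A B. k_ideal S A \<and> k_ideal S B \<and> ideal_prod S A B \<subseteq> I \<longrightarrow> A \<subseteq> I \<or> B \<subseteq> I)"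

definition Spec_k :: "('a, 'm) ring_scheme \<Rightarrow> 'a set set" where
  "Spec_k S = {P. k_prime S P}"

definition k_contraction ::
    "('a, 'm) ring_scheme \<Rightarrow> ('a \<Rightarrow> 'b) \<Rightarrow> 'b set \<Rightarrow> 'a set" where
  "k_contraction S \<phi> J = {x \<in> carrier S. \<phi> x \<in> J}"

definition k_extension ::
    "('b, 'n) ring_scheme \<Rightarrow> ('a \<Rightarrow> 'b) \<Rightarrow> 'a set \<Rightarrow> 'b set" where
  "k_extension S' \<phi> I = k_closure S' (gen_semiring_ideal S' (\<phi> ` I))"

definition k_contracted ::
    "('a, 'm) ring_scheme \<Rightarrow> ('b, 'n) ring_scheme \<Rightarrow> ('a \<Rightarrow> 'b) \<Rightarrow> 'a set \<Rightarrow> bool" where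
  "k_contracted S S' \<phi> I \<longleftrightarrow> (\<exists>J. k_ideal S' J \<and> I = k_contraction S \<phi> J)"

definition k_extended ::
    "('a, 'm) ring_scheme \<Rightarrow> ('b, 'n) ring_scheme \<Rightarrow> ('a \<Rightarrow> 'b) \<Rightarrow> 'b set \<Rightarrow> bool" where
  "k_extended S S' \<phi> J \<longleftrightarrow> (\<exists>I. k_ideal S I \<and> J = k_extension S' \<phi> I)"

(* The map \<phi>_! from Spec_k S' to Spec_k S; its value outside Spec_k S' is undefined. *)
definition Spec_k_map ::
    "('a, 'm) ring_scheme \<Rightarrow> ('b, 'n) ring_scheme \<Rightarrow> ('a \<Rightarrow> 'b) \<Rightarrow> 'b set \<Rightarrow> 'a set" where
  "Spec_k_map S S' \<phi> = (\<lambda>Q\<in>Spec_k S'. k_contraction S \<phi> Q)"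

end

theory Submission
  imports Defs
begin

text \<open>
  The substance is the nontrivial direction of (1). If \<open>P\<^sup>e\<^sup>c = P\<close>, then \<open>P\<^sup>e\<close> is disjoint from the
  multiplicatively closed set \<open>T = \<phi>(S - P)\<close>. A \<open>k\<close>-ideal \<open>Q\<close> containing \<open>P\<^sup>e\<close> and maximal among those
  disjoint from \<open>T\<close> is \<open>k\<close>-prime and contracts to \<open>P\<close>. Closures are controlled by colon ideals:
  \<open>(I : Y)\<close> is again a \<open>k\<close>-ideal, hence \<open>X Y \<subseteq> I\<close> passes from sets to the \<open>k\<close>-ideals they generate.
  Parts (2) and (3) then follow from the Galois connection between extension and contraction.
\<close>

section \<open>Commutative semirings and basic rules for k-ideals\<close>

locale csemiring = semiring S + comm_monoid S for S (structure)

lemma comm_semiring_struct_iff_csemiring: "comm_semiring_struct S \<longleftrightarrow> csemiring S"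
  by (simp add: comm_semiring_struct_def csemiring_def)

lemma semiring_idealD:
  assumes "semiring_ideal S I"
  shows "I \<subseteq> carrier S" "I \<noteq> {}"
    and "\<lbrakk>x \<in> I; y \<in> I\<rbrakk> \<Longrightarrow> x \<oplus>\<^bsub>S\<^esub> y \<in> I"
    and "\<lbrakk>s \<in> carrier S; x \<in> I\<rbrakk> \<Longrightarrow> s \<otimes>\<^bsub>S\<^esub> x \<in> I"
  using assms unfolding semiring_ideal_def by blast+

lemma k_ideal_imp_semiring_ideal: "k_ideal S I \<Longrightarrow> semiring_ideal S I"
  by (simp add: k_ideal_def)

lemmas k_idealD = semiring_idealD[OF k_ideal_imp_semiring_ideal]

lemma k_idealI:
  assumes "I \<subseteq> carrier S" "I \<noteq> {}"
    and "\<And>x y. \<lbrakk>x \<in> I; y \<in> I\<rbrakk> \<Longrightarrow> x \<oplus>\<^bsub>S\<^esub> y \<in> I"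
    and "\<And>s x. \<lbrakk>s \<in> carrier S; x \<in> I\<rbrakk> \<Longrightarrow> s \<otimes>\<^bsub>S\<^esub> x \<in> I"
    and "\<And>x y. \<lbrakk>x \<in> carrier S; x \<oplus>\<^bsub>S\<^esub> y \<in> I; y \<in> I\<rbrakk> \<Longrightarrow> x \<in> I"
  shows "k_ideal S I"
  unfolding k_ideal_def semiring_ideal_def
proof (intro conjI ballI impI)
  fix x y assume "x \<in> carrier S" "x \<oplus>\<^bsub>S\<^esub> y \<in> I \<and> y \<in> I"
  then show "x \<in> I"
    using assms(5)[of x y] by simp
qed (fact assms | rule assms(3,4); assumption)+

lemma k_ideal_cancel:
  "\<lbrakk>k_ideal S I; x \<in> carrier S; x \<oplus>\<^bsub>S\<^esub> y \<in> I; y \<in> I\<rbrakk> \<Longrightarrow> x \<in> I"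
  unfolding k_ideal_def semiring_ideal_def by (meson subsetD)

text \<open>For \<open>X\<close> inside the carrier this is the least k-ideal containing
  \<open>X\<close>. With \<open>X\<close> the image of an ideal it is the body of
  \<open>k_extension\<close>, so facts on spans transfer to extensions.\<close>

definition k_span :: "('a, 'm) ring_scheme \<Rightarrow> 'a set \<Rightarrow> 'a set" where
  "k_span S X = k_closure S (gen_semiring_ideal S X)"

text \<open>\<open>Y\<close> is an arbitrary set, so that it can be first a set of generators and
  then a whole span.\<close>

definition k_colon :: "('a, 'm) ring_scheme \<Rightarrow> 'a set \<Rightarrow> 'a set \<Rightarrow> 'a set" where
  "k_colon S I Y = {x \<in> carrier S. \<forall>y\<in>Y. x \<otimes>\<^bsub>S\<^esub> y \<in> I}"

section \<open>Generated k-ideals, k-closure and colon ideals\<close>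

context csemiring
begin

lemma zero_mem_semiring_ideal:
  assumes "semiring_ideal S I"
  shows "\<zero> \<in> I"
proof -
  obtain x where "x \<in> I"
    using semiring_idealD(2)[OF assms] by blast
  moreover from this have "\<zero> \<otimes> x = \<zero>"
    using semiring_idealD(1)[OF assms] by auto
  ultimately show ?thesis
    using semiring_idealD(4)[OF assms zero_closed] by metis
qed

lemma semiring_ideal_carrier: "semiring_ideal S (carrier S)"
  by (auto simp: semiring_ideal_def)

lemma semiring_ideal_gen:
  assumes "X \<subseteq> carrier S"
  shows "semiring_ideal S (gen_semiring_ideal S X)"
proof -
  \<comment> \<open>The carrier belongs to the intersected family and bounds it;
    \<open>Inter\<close> of an empty family would be the whole type.\<close>
  have "gen_semiring_ideal S X \<subseteq> carrier S"
    using semiring_ideal_carrier assms by (auto simp: gen_semiring_ideal_def)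
  moreover have "\<zero> \<in> gen_semiring_ideal S X"
    by (auto simp: gen_semiring_ideal_def zero_mem_semiring_ideal)
  ultimately show ?thesis
    unfolding semiring_ideal_def gen_semiring_ideal_def by blast
qed

lemma subset_k_closure:
  assumes "semiring_ideal S I"
  shows "I \<subseteq> k_closure S I"
  using semiring_idealD[OF assms] by (auto simp: k_closure_def)

lemma k_ideal_k_closure:
  assumes "semiring_ideal S I"
  shows "k_ideal S (k_closure S I)"
proof -
  note I = semiring_idealD[OF assms]
  have carr: "x \<in> carrier S" if "x \<in> I" for x
    using that I(1) by blast
  have add: "x \<oplus> y \<in> k_closure S I" if xy: "x \<in> k_closure S I" "y \<in> k_closure S I" for x y
  proof -
    from xy obtain i j where *: "x \<in> carrier S" "y \<in> carrier S" "i \<in> I" "x \<oplus> i \<in> I" "j \<in> I" "y \<oplus> j \<in> I"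
      by (auto simp: k_closure_def)
    have "(x \<oplus> y) \<oplus> (i \<oplus> j) = (x \<oplus> i) \<oplus> (y \<oplus> j)"
      using * carr by (simp add: a_ac)
    with * I(3) show ?thesis
      by (auto simp: k_closure_def intro!: bexI[of _ "i \<oplus> j"])
  qed
  have mult: "s \<otimes> x \<in> k_closure S I" if sx: "s \<in> carrier S" "x \<in> k_closure S I" for s x
  proof -
    from sx obtain i where *: "x \<in> carrier S" "i \<in> I" "x \<oplus> i \<in> I"
      by (auto simp: k_closure_def)
    have "s \<otimes> x \<oplus> s \<otimes> i = s \<otimes> (x \<oplus> i)"
      using * sx carr by (simp add: r_distr)
    with * sx I(4) show ?thesis
      by (auto simp: k_closure_def intro!: bexI[of _ "s \<otimes> i"])
  qed
  have cancel: "x \<in> k_closure S I"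
    if xy: "x \<in> carrier S" "x \<oplus> y \<in> k_closure S I" "y \<in> k_closure S I" for x y
  proof -
    from xy obtain i j where *: "y \<in> carrier S" "i \<in> I" "(x \<oplus> y) \<oplus> i \<in> I" "j \<in> I" "y \<oplus> j \<in> I"
      by (auto simp: k_closure_def)
    \<comment> \<open>The witness \<open>(y \<oplus> j) \<oplus> i\<close> lies in \<open>I\<close>
      because \<open>y \<oplus> j\<close> and \<open>i\<close> do; adding \<open>x\<close> to it
      regroups as a sum of two elements of \<open>I\<close>.\<close>
    have "x \<oplus> ((y \<oplus> j) \<oplus> i) = ((x \<oplus> y) \<oplus> i) \<oplus> j"
      using * xy(1) carr by (simp add: a_ac)
    with * xy(1) I(3) show ?thesis
      by (auto simp: k_closure_def intro!: bexI[of _ "(y \<oplus> j) \<oplus> i"])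
  qed
  have "k_closure S I \<subseteq> carrier S"
    by (auto simp: k_closure_def)
  moreover have "k_closure S I \<noteq> {}"
    using subset_k_closure[OF assms] I(2) by blast
  ultimately show ?thesis
    using add mult cancel by (rule k_idealI)
qed

lemma k_ideal_k_span: "X \<subseteq> carrier S \<Longrightarrow> k_ideal S (k_span S X)"
  by (simp add: k_span_def k_ideal_k_closure semiring_ideal_gen)

lemma subset_k_span:
  assumes "X \<subseteq> carrier S"
  shows "X \<subseteq> k_span S X"
proof -
  have "X \<subseteq> gen_semiring_ideal S X"
    by (auto simp: gen_semiring_ideal_def)
  also have "\<dots> \<subseteq> k_span S X"
    unfolding k_span_def by (intro subset_k_closure semiring_ideal_gen assms)
  finally show ?thesis .
qed

text \<open>\<open>I\<close> is one of the ideals intersected in the generated ideal, and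
  cancellation in \<open>I\<close> absorbs the closure.\<close>

lemma k_span_least:
  assumes "k_ideal S I" "X \<subseteq> I"
  shows "k_span S X \<subseteq> I"
proof -
  have "gen_semiring_ideal S X \<subseteq> I"
    using assms by (auto simp: gen_semiring_ideal_def k_ideal_def)
  then show ?thesis
    by (auto simp: k_span_def k_closure_def intro: k_ideal_cancel[OF assms(1)])
qed

text \<open>Multiplication by a fixed \<open>y\<close> is additive and commutes with multiplication
  by \<open>s\<close>, so every closure condition on \<open>I\<close>, cancellation included, pulls
  back along it.\<close>

lemma k_ideal_k_colon:
  assumes I: "k_ideal S I" and Y: "Y \<subseteq> carrier S"
  shows "k_ideal S (k_colon S I Y)"
proof -
  have carr: "y \<in> carrier S" if "y \<in> Y" for y
    using that Y by blast
  have "\<zero> \<in> k_colon S I Y"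
    using carr zero_mem_semiring_ideal[OF k_ideal_imp_semiring_ideal[OF I]]
    by (auto simp: k_colon_def)
  then have "k_colon S I Y \<subseteq> carrier S" "k_colon S I Y \<noteq> {}"
    by (auto simp: k_colon_def)
  moreover have "x \<oplus> z \<in> k_colon S I Y" if "x \<in> k_colon S I Y" "z \<in> k_colon S I Y" for x z
    using that carr k_idealD(3)[OF I] by (auto simp: k_colon_def l_distr)
  moreover have "s \<otimes> x \<in> k_colon S I Y" if "s \<in> carrier S" "x \<in> k_colon S I Y" for s x
    using that carr k_idealD(4)[OF I] by (auto simp: k_colon_def m_assoc)
  moreover have "x \<in> k_colon S I Y"
    if "x \<in> carrier S" "x \<oplus> z \<in> k_colon S I Y" "z \<in> k_colon S I Y" for x z
    unfolding k_colon_def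
  proof (intro CollectI conjI ballI)
    fix y assume "y \<in> Y"
    then show "x \<otimes> y \<in> I"
      using that carr k_ideal_cancel[OF I, of "x \<otimes> y" "z \<otimes> y"]
      by (auto simp: k_colon_def l_distr)
  qed fact
  ultimately show ?thesis
    by (rule k_idealI)
qed

text \<open>Minimality of spans is applied once in each factor: first \<open>X\<close>, hence its
  span, lies in \<open>(I : Y)\<close>; then \<open>Y\<close>, hence its span, lies in the colon
  ideal of \<open>I\<close> by the span of \<open>X\<close>. Commutativity swaps the factors in
  between.\<close>

lemma k_span_mult_mem:
  assumes I: "k_ideal S I" and X: "X \<subseteq> carrier S" and Y: "Y \<subseteq> carrier S"
    and XY: "\<And>x y. \<lbrakk>x \<in> X; y \<in> Y\<rbrakk> \<Longrightarrow> x \<otimes> y \<in> I"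
    and a: "a \<in> k_span S X" and b: "b \<in> k_span S Y"
  shows "a \<otimes> b \<in> I"
proof -
  note KX = k_idealD(1)[OF k_ideal_k_span[OF X]]
  have "X \<subseteq> k_colon S I Y"
    using X XY by (auto simp: k_colon_def)
  then have "k_span S X \<subseteq> k_colon S I Y"
    by (rule k_span_least[OF k_ideal_k_colon[OF I Y]])
  then have "x \<otimes> y \<in> I" if "x \<in> k_span S X" "y \<in> Y" for x y
    using that by (auto simp: k_colon_def)
  then have "y \<otimes> x \<in> I" if "x \<in> k_span S X" "y \<in> Y" for x y
    using that m_comm[of x y] Y KX by (metis subsetD)
  then have "Y \<subseteq> k_colon S I (k_span S X)"
    using Y by (auto simp: k_colon_def)
  then have "k_span S Y \<subseteq> k_colon S I (k_span S X)"
    by (rule k_span_least[OF k_ideal_k_colon[OF I KX]])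
  with a b have "b \<in> carrier S" "b \<otimes> a \<in> I"
    by (auto simp: k_colon_def)
  moreover have "a \<in> carrier S"
    using a KX by blast
  ultimately show ?thesis
    by (simp add: m_comm)
qed

section \<open>Elementwise description of k-primes\<close>

lemma ideal_prod_subset:
  assumes I: "k_ideal S I" and "\<And>a b. \<lbrakk>a \<in> A; b \<in> B\<rbrakk> \<Longrightarrow> a \<otimes> b \<in> I"
  shows "ideal_prod S A B \<subseteq> I"
proof
  fix x assume "x \<in> ideal_prod S A B"
  then show "x \<in> I"
    by (induction rule: ideal_prod.induct) (auto intro: assms(2) k_idealD(3)[OF I])
qed

text \<open>If \<open>a \<otimes> b\<close> lies in \<open>P\<close>, so does the product of the
  k-ideals spanned by \<open>a\<close> and by \<open>b\<close>, by \<open>k_span_mult_mem\<close>.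
  Conversely, elements of \<open>A\<close> and \<open>B\<close> outside \<open>P\<close> would have
  their product in \<open>P\<close>. Later arguments use the elementwise form.\<close>

lemma k_prime_iff:
  assumes P: "k_ideal S P"
  shows "k_prime S P \<longleftrightarrow>
    (\<forall>a\<in>carrier S. \<forall>b\<in>carrier S. a \<otimes> b \<in> P \<longrightarrow> a \<in> P \<or> b \<in> P)" (is "_ \<longleftrightarrow> ?elementwise")
proof
  assume prime: "k_prime S P"
  show ?elementwise
  proof (intro ballI impI)
    fix a b assume ab: "a \<in> carrier S" "b \<in> carrier S" "a \<otimes> b \<in> P"
    have "ideal_prod S (k_span S {a}) (k_span S {b}) \<subseteq> P"
    proof (rule ideal_prod_subset[OF P])
      fix x y assume "x \<in> k_span S {a}" "y \<in> k_span S {b}"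
      then show "x \<otimes> y \<in> P"
        by (rule k_span_mult_mem[OF P, rotated 3]) (use ab in simp_all)
    qed
    moreover have "k_ideal S (k_span S {a})" "k_ideal S (k_span S {b})"
      using ab by (simp_all add: k_ideal_k_span)
    ultimately have "k_span S {a} \<subseteq> P \<or> k_span S {b} \<subseteq> P"
      using prime unfolding k_prime_def by blast
    moreover have "a \<in> k_span S {a}" "b \<in> k_span S {b}"
      using subset_k_span[of "{a}"] subset_k_span[of "{b}"] ab by simp_all
    ultimately show "a \<in> P \<or> b \<in> P"
      by blast
  qed
next
  assume elementwise: ?elementwise
  have "A \<subseteq> P \<or> B \<subseteq> P"
    if A: "k_ideal S A" and B: "k_ideal S B" and AB: "ideal_prod S A B \<subseteq> P" for A B
  proof (rule ccontr)
    assume "\<not> (A \<subseteq> P \<or> B \<subseteq> P)"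
    then obtain a b where ab: "a \<in> A" "a \<notin> P" "b \<in> B" "b \<notin> P"
      by blast
    then have "a \<otimes> b \<in> P"
      using AB ideal_prod.prod[of a A b B S] by blast
    moreover have "a \<in> carrier S" "b \<in> carrier S"
      using ab k_idealD(1)[OF A] k_idealD(1)[OF B] by blast+
    ultimately show False
      using ab elementwise by blast
  qed
  with P show "k_prime S P"
    unfolding k_prime_def by blast
qed

section \<open>Existence of k-primes by Zorn's lemma\<close>

lemma k_ideal_Union_chain:
  assumes "C \<noteq> {}" and k: "\<And>I. I \<in> C \<Longrightarrow> k_ideal S I"
    and chain: "\<And>I J. \<lbrakk>I \<in> C; J \<in> C\<rbrakk> \<Longrightarrow> I \<subseteq> J \<or> J \<subseteq> I"
  shows "k_ideal S (\<Union>C)"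
proof -
  \<comment> \<open>Addition and cancellation each involve two elements; in a chain one member
    contains both.\<close>
  have join: "\<exists>I\<in>C. x \<in> I \<and> y \<in> I" if xy: "x \<in> \<Union>C" "y \<in> \<Union>C" for x y
  proof -
    obtain I J where "I \<in> C" "x \<in> I" "J \<in> C" "y \<in> J"
      using xy by blast
    then show ?thesis
      using chain[of I J] by blast
  qed
  show ?thesis
  proof (rule k_idealI)
    show "\<Union>C \<subseteq> carrier S"
      using k_idealD(1)[OF k] by blast
    show "\<Union>C \<noteq> {}"
      using assms(1) k_idealD(2)[OF k] by blast
    show "x \<oplus> y \<in> \<Union>C" if xy: "x \<in> \<Union>C" "y \<in> \<Union>C" for x y
    proof -
      obtain I where "I \<in> C" "x \<in> I" "y \<in> I"
        using join[OF xy] by blast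
      then show ?thesis
        using k_idealD(3)[OF k] by (intro UnionI)
    qed
    show "s \<otimes> x \<in> \<Union>C" if sx: "s \<in> carrier S" "x \<in> \<Union>C" for s x
    proof -
      obtain I where "I \<in> C" "x \<in> I"
        using sx(2) by blast
      then show ?thesis
        using k_idealD(4)[OF k] sx(1) by (intro UnionI)
    qed
    show "x \<in> \<Union>C" if xy: "x \<in> carrier S" "x \<oplus> y \<in> \<Union>C" "y \<in> \<Union>C" for x y
    proof -
      obtain I where "I \<in> C" "x \<oplus> y \<in> I" "y \<in> I"
        using join[OF xy(2,3)] by blast
      then show ?thesis
        using k_ideal_cancel[OF k] xy(1) by (intro UnionI)
    qed
  qed
qed

text \<open>Let \<open>Q\<close> be maximal and \<open>a\<close>, \<open>b\<close> outside it with
  \<open>a \<otimes> b\<close> in \<open>Q\<close>. Adjoining \<open>a\<close> or \<open>b\<close>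
  to \<open>Q\<close> yields spans that meet \<open>T\<close>, in \<open>s\<close> and
  \<open>t\<close> say; then \<open>s \<otimes> t\<close> lies in both \<open>T\<close> and
  \<open>Q\<close>. For empty \<open>T\<close> the maximal k-ideal is the carrier, which counts as
  k-prime.\<close>

lemma exists_k_prime_disjoint:
  assumes I: "k_ideal S I" and disj: "I \<inter> T = {}"
    and T: "\<And>s t. \<lbrakk>s \<in> T; t \<in> T\<rbrakk> \<Longrightarrow> s \<otimes> t \<in> T"
  obtains Q where "k_prime S Q" "I \<subseteq> Q" "Q \<inter> T = {}"
proof -
  define F where "F = {J. k_ideal S J \<and> I \<subseteq> J \<and> J \<inter> T = {}}"
  have "\<exists>M\<in>F. \<forall>X\<in>F. M \<subseteq> X \<longrightarrow> X = M"
  \<comment> \<open>As \<open>I\<close> is in \<open>F\<close>, upper bounds are required for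
    nonempty chains only; the empty union is not a k-ideal.\<close>
  proof (rule subset_Zorn_nonempty)
    show "F \<noteq> {}"
      using I disj by (auto simp: F_def)
    fix C assume C: "C \<noteq> {}" "subset.chain F C"
    then have "k_ideal S (\<Union>C)"
      by (intro k_ideal_Union_chain) (auto simp: F_def subset_chain_def)
    then show "\<Union>C \<in> F"
      using C by (auto simp: F_def subset_chain_def)
  qed
  then obtain Q where Q: "k_ideal S Q" "I \<subseteq> Q" "Q \<inter> T = {}"
    and max: "\<And>X. \<lbrakk>k_ideal S X; I \<subseteq> X; X \<inter> T = {}; Q \<subseteq> X\<rbrakk> \<Longrightarrow> X = Q"
    by (auto simp: F_def)
  note QS = k_idealD(1)[OF Q(1)]
  have meets: "\<exists>t\<in>T. t \<in> k_span S (insert a Q)" if "a \<in> carrier S" "a \<notin> Q" for a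
  proof -
    have "insert a Q \<subseteq> carrier S"
      using that QS by auto
    note K = k_ideal_k_span[OF this] subset_k_span[OF this]
    then have "k_span S (insert a Q) \<noteq> Q"
      using that by blast
    with max[OF K(1)] K(2) Q(2) show ?thesis
      by blast
  qed
  have "a \<in> Q \<or> b \<in> Q" if ab: "a \<in> carrier S" "b \<in> carrier S" "a \<otimes> b \<in> Q" for a b
  proof (rule ccontr)
    assume "\<not> (a \<in> Q \<or> b \<in> Q)"
    then obtain s t where st: "s \<in> T" "t \<in> T"
      "s \<in> k_span S (insert a Q)" "t \<in> k_span S (insert b Q)"
      using meets ab by blast
    \<comment> \<open>Products of generators have a factor in \<open>Q\<close> or equal
      \<open>a \<otimes> b\<close>.\<close>
    have "x \<otimes> y \<in> Q" if "x \<in> insert a Q" "y \<in> insert b Q" for x y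
    proof -
      have carr: "x \<in> carrier S" "y \<in> carrier S"
        using that ab QS by auto
      have "x \<otimes> y \<in> Q" if "y \<in> Q"
        using k_idealD(4)[OF Q(1) carr(1) that] .
      moreover have "x \<otimes> y \<in> Q" if "x \<in> Q"
        using k_idealD(4)[OF Q(1) carr(2) that] m_comm[OF carr] by simp
      ultimately show ?thesis
        using \<open>x \<in> insert a Q\<close> \<open>y \<in> insert b Q\<close> ab(3) by blast
    qed
    then have "s \<otimes> t \<in> Q"
      using ab QS by (intro k_span_mult_mem[OF Q(1) _ _ _ st(3,4)]) auto
    with T[OF st(1,2)] Q(3) show False
      by blast
  qed
  then have "k_prime S Q"
    using k_prime_iff[OF Q(1)] by blast
  with Q that show thesis
    by blast
qed

end

section \<open>Contraction and extension along a homomorphism\<close>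

locale csemiring_hom = S: csemiring S + S': csemiring S'
  for S :: "('a, 'm) ring_scheme" and S' :: "('b, 'n) ring_scheme" +
  fixes \<phi> :: "'a \<Rightarrow> 'b"
  assumes hom: "\<phi> \<in> semiring_hom S S'"
begin

lemma hom_simps:
  shows "x \<in> carrier S \<Longrightarrow> \<phi> x \<in> carrier S'"
    and "\<lbrakk>x \<in> carrier S; y \<in> carrier S\<rbrakk> \<Longrightarrow> \<phi> (x \<oplus>\<^bsub>S\<^esub> y) = \<phi> x \<oplus>\<^bsub>S'\<^esub> \<phi> y"
    and "\<lbrakk>x \<in> carrier S; y \<in> carrier S\<rbrakk> \<Longrightarrow> \<phi> (x \<otimes>\<^bsub>S\<^esub> y) = \<phi> x \<otimes>\<^bsub>S'\<^esub> \<phi> y"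
    and "\<phi> \<zero>\<^bsub>S\<^esub> = \<zero>\<^bsub>S'\<^esub>"
  using hom by (auto simp: semiring_hom_def dest: ring_hom_closed ring_hom_add ring_hom_mult)

lemma k_ideal_contraction:
  assumes J: "k_ideal S' J"
  shows "k_ideal S (k_contraction S \<phi> J)"
proof (rule k_idealI)
  \<comment> \<open>Preservation of zero makes the preimage nonempty.\<close>
  have "\<zero>\<^bsub>S\<^esub> \<in> k_contraction S \<phi> J"
    using S'.zero_mem_semiring_ideal[OF k_ideal_imp_semiring_ideal[OF J]]
    by (simp add: k_contraction_def hom_simps)
  then show "k_contraction S \<phi> J \<noteq> {}"
    by blast
  show "k_contraction S \<phi> J \<subseteq> carrier S"
    by (auto simp: k_contraction_def)
  show "x \<oplus>\<^bsub>S\<^esub> y \<in> k_contraction S \<phi> J"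
    if "x \<in> k_contraction S \<phi> J" "y \<in> k_contraction S \<phi> J" for x y
    using that k_idealD(3)[OF J] by (simp add: k_contraction_def hom_simps)
  show "s \<otimes>\<^bsub>S\<^esub> x \<in> k_contraction S \<phi> J"
    if "s \<in> carrier S" "x \<in> k_contraction S \<phi> J" for s x
    using that k_idealD(4)[OF J] by (simp add: k_contraction_def hom_simps)
  show "x \<in> k_contraction S \<phi> J"
    if "x \<in> carrier S" "x \<oplus>\<^bsub>S\<^esub> y \<in> k_contraction S \<phi> J" "y \<in> k_contraction S \<phi> J" for x y
    using that k_ideal_cancel[OF J, of "\<phi> x" "\<phi> y"] by (simp add: k_contraction_def hom_simps)
qed

lemma k_prime_contraction:
  assumes "k_prime S' Q"
  shows "k_prime S (k_contraction S \<phi> Q)"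
proof -
  have Q: "k_ideal S' Q"
    using assms by (simp add: k_prime_def)
  have "a \<in> k_contraction S \<phi> Q \<or> b \<in> k_contraction S \<phi> Q"
    if "a \<in> carrier S" "b \<in> carrier S" "a \<otimes>\<^bsub>S\<^esub> b \<in> k_contraction S \<phi> Q" for a b
  proof -
    have "\<phi> a \<otimes>\<^bsub>S'\<^esub> \<phi> b \<in> Q"
      using that by (simp add: k_contraction_def hom_simps)
    then have "\<phi> a \<in> Q \<or> \<phi> b \<in> Q"
      using assms S'.k_prime_iff[OF Q] that(1,2) hom_simps(1) by blast
    with that(1,2) show ?thesis
      by (simp add: k_contraction_def)
  qed
  then show ?thesis
    using S.k_prime_iff[OF k_ideal_contraction[OF Q]] by blast
qed

lemma k_extension_eq_k_span: "k_extension S' \<phi> I = k_span S' (\<phi> ` I)"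
  by (simp add: k_extension_def k_span_def)

lemma image_subset_carrier: "I \<subseteq> carrier S \<Longrightarrow> \<phi> ` I \<subseteq> carrier S'"
  by (auto simp: hom_simps)

lemma k_ideal_extension: "I \<subseteq> carrier S \<Longrightarrow> k_ideal S' (k_extension S' \<phi> I)"
  unfolding k_extension_eq_k_span by (intro S'.k_ideal_k_span image_subset_carrier)

text \<open>The Galois connection: both sides say that \<open>\<phi>\<close> maps \<open>I\<close>
  into \<open>J\<close>, because a k-ideal contains the span of a set as soon as it contains the
  set.\<close>

lemma k_extension_subset_iff:
  assumes "k_ideal S' J" and "I \<subseteq> carrier S"
  shows "k_extension S' \<phi> I \<subseteq> J \<longleftrightarrow> I \<subseteq> k_contraction S \<phi> J"
proof
  assume "k_extension S' \<phi> I \<subseteq> J"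
  then have "\<phi> ` I \<subseteq> J"
    using S'.subset_k_span[OF image_subset_carrier[OF assms(2)]]
    by (simp add: k_extension_eq_k_span)
  then show "I \<subseteq> k_contraction S \<phi> J"
    using assms(2) by (auto simp: k_contraction_def)
next
  assume "I \<subseteq> k_contraction S \<phi> J"
  then show "k_extension S' \<phi> I \<subseteq> J"
    unfolding k_extension_eq_k_span
    by (intro S'.k_span_least assms) (auto simp: k_contraction_def)
qed

lemma k_contraction_mono: "J \<subseteq> J' \<Longrightarrow> k_contraction S \<phi> J \<subseteq> k_contraction S \<phi> J'"
  by (auto simp: k_contraction_def)

lemma k_contraction_subset_carrier: "k_contraction S \<phi> J \<subseteq> carrier S"
  by (auto simp: k_contraction_def)

lemma subset_contraction_extension:
  "I \<subseteq> carrier S \<Longrightarrow> I \<subseteq> k_contraction S \<phi> (k_extension S' \<phi> I)"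
  using k_extension_subset_iff[OF k_ideal_extension] by blast

text \<open>If \<open>I = J^c\<close>, then \<open>I^e\<close> is contained in \<open>J\<close> by
  the Galois connection, so \<open>I^ec\<close> is contained in \<open>J^c = I\<close>; the other
  inclusion always holds. Thus \<open>I^e\<close> is a canonical witness for being
  k-contracted.\<close>

lemma k_contracted_iff:
  assumes "I \<subseteq> carrier S"
  shows "k_contracted S S' \<phi> I \<longleftrightarrow> k_contraction S \<phi> (k_extension S' \<phi> I) = I"
proof
  assume "k_contracted S S' \<phi> I"
  then obtain J where J: "k_ideal S' J" "I = k_contraction S \<phi> J"
    by (auto simp: k_contracted_def)
  then have "k_extension S' \<phi> I \<subseteq> J"
    using k_extension_subset_iff[OF J(1) assms] by simp
  with J(2) have "k_contraction S \<phi> (k_extension S' \<phi> I) \<subseteq> I"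
    using k_contraction_mono by blast
  with subset_contraction_extension[OF assms]
  show "k_contraction S \<phi> (k_extension S' \<phi> I) = I"
    by blast
next
  assume "k_contraction S \<phi> (k_extension S' \<phi> I) = I"
  then show "k_contracted S S' \<phi> I"
    using k_ideal_extension[OF assms] by (auto simp: k_contracted_def)
qed

text \<open>This is the identity \<open>I^ece = I^e\<close> of a Galois connection. The chain from
  \<open>I\<close> through \<open>I^ec\<close> to \<open>I^ecec\<close> transposes to one inclusion,
  and \<open>Q^ce\<close> is always contained in \<open>Q\<close>.\<close>

lemma k_extended_imp_extension_contraction:
  assumes "k_extended S S' \<phi> Q"
  shows "k_extension S' \<phi> (k_contraction S \<phi> Q) = Q"
proof -
  obtain I where I: "k_ideal S I" "Q = k_extension S' \<phi> I"
    using assms by (auto simp: k_extended_def)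
  note IS = k_idealD(1)[OF I(1)]
  have Q: "k_ideal S' Q"
    using k_ideal_extension[OF IS] I(2) by simp
  let ?E = "k_extension S' \<phi> (k_contraction S \<phi> Q)"
  have E: "k_ideal S' ?E"
    by (rule k_ideal_extension[OF k_contraction_subset_carrier])
  have "I \<subseteq> k_contraction S \<phi> Q"
    using subset_contraction_extension[OF IS] I(2) by simp
  also have "\<dots> \<subseteq> k_contraction S \<phi> ?E"
    by (rule subset_contraction_extension[OF k_contraction_subset_carrier])
  finally have "Q \<subseteq> ?E"
    using k_extension_subset_iff[OF E IS] I(2) by simp
  moreover have "?E \<subseteq> Q"
    using k_extension_subset_iff[OF Q k_contraction_subset_carrier] by simp
  ultimately show ?thesis
    by blast
qed

text \<open>Phrased with \<open>k_contracted\<close>, it serves (2) directly and (1) through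
  \<open>k_contracted_iff\<close>.\<close>

lemma k_contraction_of_k_prime_iff:
  assumes P: "k_prime S P"
  shows "(\<exists>Q\<in>Spec_k S'. P = k_contraction S \<phi> Q) \<longleftrightarrow> k_contracted S S' \<phi> P"
proof
  assume "\<exists>Q\<in>Spec_k S'. P = k_contraction S \<phi> Q"
  then show "k_contracted S S' \<phi> P"
    by (auto simp: k_contracted_def Spec_k_def k_prime_def)
next
  assume contracted: "k_contracted S S' \<phi> P"
  have Pk: "k_ideal S P"
    using P by (simp add: k_prime_def)
  note PS = k_idealD(1)[OF Pk]
  define T where "T = \<phi> ` (carrier S - P)"
  \<comment> \<open>A common element would be \<open>\<phi> x\<close> with \<open>x\<close> outside
    \<open>P\<close>, yet in \<open>P^ec = P\<close>.\<close>
  have "k_extension S' \<phi> P \<inter> T = {}"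
    using contracted PS by (auto simp: T_def k_contracted_iff k_contraction_def)
  moreover have "s \<otimes>\<^bsub>S'\<^esub> t \<in> T" if st: "s \<in> T" "t \<in> T" for s t
  proof -
    obtain x y where xy: "x \<in> carrier S - P" "y \<in> carrier S - P" "s = \<phi> x" "t = \<phi> y"
      using st unfolding T_def by blast
    then have "x \<otimes>\<^bsub>S\<^esub> y \<in> carrier S - P"
      using P S.k_prime_iff[OF Pk] by auto
    moreover have "s \<otimes>\<^bsub>S'\<^esub> t = \<phi> (x \<otimes>\<^bsub>S\<^esub> y)"
      using xy by (simp add: hom_simps)
    ultimately show ?thesis
      by (auto simp: T_def)
  qed
  ultimately obtain Q where Q: "k_prime S' Q" "k_extension S' \<phi> P \<subseteq> Q" "Q \<inter> T = {}"
    using S'.exists_k_prime_disjoint[OF k_ideal_extension[OF PS]] by blast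
  have "P \<subseteq> k_contraction S \<phi> Q"
    using Q PS k_extension_subset_iff by (simp add: k_prime_def)
  \<comment> \<open>Disjointness from \<open>T\<close> says that \<open>\<phi>\<close> sends no
    element outside \<open>P\<close> into \<open>Q\<close>.\<close>
  moreover have "k_contraction S \<phi> Q \<subseteq> P"
    using Q(3) by (auto simp: T_def k_contraction_def)
  ultimately show "\<exists>Q\<in>Spec_k S'. P = k_contraction S \<phi> Q"
    using Q(1) by (auto simp: Spec_k_def)
qed

text \<open>Contractions of k-primes are k-prime, so only one inclusion is at stake. On its domain
  the restricted map agrees with contraction, so the value \<open>undefined\<close> does not enter
  the image.\<close>

lemma Spec_k_map_surj_iff:
  "Spec_k_map S S' \<phi> ` Spec_k S' = Spec_k S \<longleftrightarrow>
    (\<forall>P\<in>Spec_k S. \<exists>Q\<in>Spec_k S'. P = k_contraction S \<phi> Q)"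
proof -
  have "Spec_k_map S S' \<phi> ` Spec_k S' = k_contraction S \<phi> ` Spec_k S'"
    by (simp add: Spec_k_map_def)
  moreover have "k_contraction S \<phi> ` Spec_k S' \<subseteq> Spec_k S"
    using k_prime_contraction by (auto simp: Spec_k_def)
  ultimately have "Spec_k_map S S' \<phi> ` Spec_k S' = Spec_k S \<longleftrightarrow>
      Spec_k S \<subseteq> k_contraction S \<phi> ` Spec_k S'"
    by (simp only: set_eq_subset[of _ "Spec_k S"] simp_thms)
  then show ?thesis
    by (simp only: subset_eq image_iff)
qed

end

theorem proposition5p6:
  fixes S :: "('a, 'm) ring_scheme" and S' :: "('b, 'n) ring_scheme" and \<phi> :: "'a \<Rightarrow> 'b"
  assumes "comm_semiring_struct S" and "comm_semiring_struct S'"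
    and "\<phi> \<in> semiring_hom S S'"
  shows "(\<forall>P\<in>Spec_k S. (\<exists>Q\<in>Spec_k S'. P = k_contraction S \<phi> Q) \<longleftrightarrow>
             k_contraction S \<phi> (k_extension S' \<phi> P) = P)
       \<and> ((\<forall>P\<in>Spec_k S. k_contracted S S' \<phi> P) \<longleftrightarrow>
             Spec_k_map S S' \<phi> ` Spec_k S' = Spec_k S)
       \<and> ((\<forall>Q\<in>Spec_k S'. k_extended S S' \<phi> Q) \<longrightarrow>
             inj_on (Spec_k_map S S' \<phi>) (Spec_k S'))"
proof -
  interpret csemiring_hom S S' \<phi>
    using assms by (simp add: csemiring_hom_def csemiring_hom_axioms_def
        comm_semiring_struct_iff_csemiring)
  have contr: "(\<exists>Q\<in>Spec_k S'. P = k_contraction S \<phi> Q) \<longleftrightarrow> k_contracted S S' \<phi> P"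
    if "P \<in> Spec_k S" for P
    using that k_contraction_of_k_prime_iff by (simp add: Spec_k_def)
  \<comment> \<open>Together with \<open>contr\<close> this yields (1); \<open>contr\<close> for all
    \<open>P\<close>, with \<open>Spec_k_map_surj_iff\<close>, yields (2).\<close>
  have "k_contracted S S' \<phi> P \<longleftrightarrow> k_contraction S \<phi> (k_extension S' \<phi> P) = P"
    if "P \<in> Spec_k S" for P
    using that k_idealD(1) by (intro k_contracted_iff) (auto simp: Spec_k_def k_prime_def)
  moreover have "inj_on (Spec_k_map S S' \<phi>) (Spec_k S')"
    if "\<forall>Q\<in>Spec_k S'. k_extended S S' \<phi> Q"
  \<comment> \<open>Extension is a left inverse of contraction on k-extended ideals.\<close>
  proof (rule inj_on_inverseI)
    fix Q assume "Q \<in> Spec_k S'"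
    then show "k_extension S' \<phi> (Spec_k_map S S' \<phi> Q) = Q"
      using that by (simp add: Spec_k_map_def k_extended_imp_extension_contraction)
  qed
  ultimately show ?thesis
    using contr by (simp add: Spec_k_map_surj_iff)
qed

end
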